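(* Let $d\ge 1$ and let $D$ be a $d$-regular oriented graph on $n$ vertices. The following polynomial-time algorithm outputs subsets $A,B\subseteq V(D)$ satisfying $e(A,B)\ge n/4$ and $e(B,A)=0$: let $A_1=\{v\}$ for an arbitrary vertex $v$; for $t=1,\dots,n-1$, choose a vertex $u\in V(D)\setminus A_t$ minimising $e^{(2)}(A_t,\{u\})$ and set $A_{t+1}=A_t\cup\{u\}$; finally output $A=A_{\lfloor n/2d\rfloor}$ and $B=\{v\in V(D): e(\{v\},A)=0\}$.
   Context: An oriented graph $D$ is a finite directed graph without loops in which, for each pair of distinct vertices $x,y$, at most one of $\vec{xy},\vec{yx}$ is an arc. It is $d$-regular if every vertex has in-degree $d$ and out-degree $d$. For (not necessarily disjoint) $A,B\subseteq V(D)$, $e(A,B)$ is the number of arcs $\vec{xy}$ of $D$ with $x\in A$, $y\in B$. A path of length two from $x$ to $z$ is a pair of arcs $\vec{xy},\vec{yz}$ (its middle vertex $y$ is an arbitrary vertex of $D$). $e^{(2)}(A)$ denotes the number of paths of length two whose start vertex and end vertex both lie in $A$. For disjoint $A,U$, $e^{(2)}(A,U)$ denotes the number of paths of length two having one of its start and end vertices in $A$ and the other in $U$ (in either direction). *)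

theory Defs
  imports
    "HOL-Computational_Algebra.Polynomial"
    "HOL-Library.Time_Functions"
    "Graph_Theory.Pair_Digraph"
begin

section \<open>Regular oriented graphs\<close>

locale oriented_graph = pair_digraph D for D :: "'a pair_pre_digraph" +
  assumes no_opposite_arcs: "(x, y) \<in> parcs D \<Longrightarrow> (y, x) \<notin> parcs D"

definition regular_digraph :: "nat \<Rightarrow> 'a pair_pre_digraph \<Rightarrow> bool" where
  "regular_digraph d D \<longleftrightarrow>
     (\<forall>v\<in>pverts D. in_degree (with_proj D) v = d \<and> out_degree (with_proj D) v = d)"

definition num_arcs :: "'a pair_pre_digraph \<Rightarrow> 'a set \<Rightarrow> 'a set \<Rightarrow> nat" where
  "num_arcs D A B = card {(x, y). (x, y) \<in> parcs D \<and> x \<in> A \<and> y \<in> B}"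

text \<open>The number $e^{(2)}(A,U)$, for disjoint \<open>A\<close> and \<open>U\<close>.\<close>

definition num_2paths :: "'a pair_pre_digraph \<Rightarrow> 'a set \<Rightarrow> 'a set \<Rightarrow> nat" where
  "num_2paths D A U = card {(x, y, z). (x, y) \<in> parcs D \<and> (y, z) \<in> parcs D \<and>
     (x \<in> A \<and> z \<in> U \<or> x \<in> U \<and> z \<in> A)}"


section \<open>The greedy procedure\<close>

text \<open>The choice of \<open>u\<close> is not determined by the procedure, so its possible runs are described by
  a relation. Only the sets \<open>S 1, \<dots>, S n\<close> matter, where \<open>n\<close> is the number of vertices.\<close>

definition greedy_run :: "'a pair_pre_digraph \<Rightarrow> 'a \<Rightarrow> (nat \<Rightarrow> 'a set) \<Rightarrow> bool" where
  "greedy_run D v S \<longleftrightarrow>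
     S 1 = {v} \<and>
     (\<forall>t\<in>{1..<card (pverts D)}. \<exists>u.
        is_arg_min (\<lambda>u. num_2paths D (S t) {u}) (\<lambda>u. u \<in> pverts D - S t) u \<and>
        S (Suc t) = S t \<union> {u})"

definition greedy_output ::
    "'a pair_pre_digraph \<Rightarrow> nat \<Rightarrow> 'a \<Rightarrow> 'a set \<Rightarrow> 'a set \<Rightarrow> bool" where
  "greedy_output D d v A B \<longleftrightarrow>
     (\<exists>S. greedy_run D v S \<and> A = S (card (pverts D) div (2 * d))) \<and>
     B = {w \<in> pverts D. num_arcs D {w} A = 0}"


section \<open>An executable version\<close>

text \<open>The vertices are numbered \<open>0, \<dots>, n - 1\<close> and the input is the adjacency matrix \<open>M\<close>.\<close>

definition represents :: "'a list \<Rightarrow> bool list list \<Rightarrow> 'a pair_pre_digraph \<Rightarrow> bool" where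
  "represents vs M D \<longleftrightarrow>
     distinct vs \<and> set vs = pverts D \<and>
     length M = length vs \<and> (\<forall>row\<in>set M. length row = length vs) \<and>
     (\<forall>i<length vs. \<forall>j<length vs. M ! i ! j \<longleftrightarrow> (vs ! i, vs ! j) \<in> parcs D)"

text \<open>The paths of length two from \<open>x\<close> to \<open>z\<close> with middle vertex below the last argument.\<close>

fun count_paths :: "bool list list \<Rightarrow> nat \<Rightarrow> nat \<Rightarrow> nat \<Rightarrow> nat" where
  "count_paths M x z 0 = 0"
| "count_paths M x z (Suc y) =
     (if M ! x ! y \<and> M ! y ! z then 1 else 0) + count_paths M x z y"

fun score :: "bool list list \<Rightarrow> nat \<Rightarrow> nat list \<Rightarrow> nat \<Rightarrow> nat" where
  "score M n [] u = 0"
| "score M n (a # as) u = count_paths M a u n + count_paths M u a n + score M n as u"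

fun minimiser :: "bool list list \<Rightarrow> nat \<Rightarrow> nat list \<Rightarrow> nat \<Rightarrow> nat list \<Rightarrow> nat" where
  "minimiser M n as u [] = u"
| "minimiser M n as u (w # ws) =
     (if score M n as w < score M n as u then minimiser M n as w ws
      else minimiser M n as u ws)"

fun vertices_except :: "nat \<Rightarrow> nat \<Rightarrow> nat list" where
  "vertices_except s 0 = []"
| "vertices_except s (Suc i) =
     (if i = s then vertices_except s i else i # vertices_except s i)"

fun delete_vertex :: "nat \<Rightarrow> nat list \<Rightarrow> nat list" where
  "delete_vertex u [] = []"
| "delete_vertex u (w # ws) = (if u = w then ws else w # delete_vertex u ws)"

text \<open>With \<open>as\<close> the current set, \<open>ws\<close> its complement and \<open>k\<close> the number of remaining steps, this
  lists the current set followed by all later ones.\<close>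

fun greedy_sets ::
    "bool list list \<Rightarrow> nat \<Rightarrow> nat \<Rightarrow> nat list \<Rightarrow> nat list \<Rightarrow> nat list list" where
  "greedy_sets M n 0 as ws = [as]"
| "greedy_sets M n (Suc k) as [] = [as]"
| "greedy_sets M n (Suc k) as (w # ws) =
     (let u = minimiser M n as w ws
      in as # greedy_sets M n k (u # as) (delete_vertex u (w # ws)))"

fun no_arc_to :: "bool list list \<Rightarrow> nat \<Rightarrow> nat list \<Rightarrow> bool" where
  "no_arc_to M v [] = True"
| "no_arc_to M v (a # as) = (\<not> M ! v ! a \<and> no_arc_to M v as)"

fun non_in_neighbours :: "bool list list \<Rightarrow> nat list \<Rightarrow> nat \<Rightarrow> nat list" where
  "non_in_neighbours M as 0 = []"
| "non_in_neighbours M as (Suc v) =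
     (if no_arc_to M v as then v # non_in_neighbours M as v else non_in_neighbours M as v)"

text \<open>List indices start at \<open>0\<close>, whence the \<open>- 1\<close> in the position of the selected set.\<close>

fun greedy_algorithm :: "bool list list \<Rightarrow> nat \<Rightarrow> nat \<Rightarrow> nat list \<times> nat list" where
  "greedy_algorithm M d s =
     (let n = length M;
          as = greedy_sets M n (n - 1) [s] (vertices_except s n) ! (n div (2 * d) - 1)
      in (as, non_in_neighbours M as n))"


section \<open>Running time\<close>

text \<open>The equations below are those which the library command \<^verbatim>\<open>time_fun\<close> of
  \<^theory>\<open>HOL-Library.Time_Commands\<close> generates for the functions above. Every call of a recursive
  function costs one step, list access and length have the cost fixed by
  \<^theory>\<open>HOL-Library.Time_Functions\<close>, and arithmetic, comparisons and Boolean connectives are free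
  (all numbers occurring in a run on a \<open>d\<close>-regular oriented graph are at most $2n^2$).\<close>

fun T_count_paths :: "bool list list \<Rightarrow> nat \<Rightarrow> nat \<Rightarrow> nat \<Rightarrow> nat" where
  "T_count_paths M x z 0 = 1"
| "T_count_paths M x z (Suc y) =
     T_nth M x + T_nth (M ! x) y + (T_nth M y + T_nth (M ! y) z) + T_count_paths M x z y + 1"

fun T_score :: "bool list list \<Rightarrow> nat \<Rightarrow> nat list \<Rightarrow> nat \<Rightarrow> nat" where
  "T_score M n [] u = 1"
| "T_score M n (a # as) u =
     T_count_paths M a u n + T_count_paths M u a n + T_score M n as u + 1"

fun T_minimiser :: "bool list list \<Rightarrow> nat \<Rightarrow> nat list \<Rightarrow> nat \<Rightarrow> nat list \<Rightarrow> nat" where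
  "T_minimiser M n as u [] = 1"
| "T_minimiser M n as u (w # ws) =
     T_score M n as w + T_score M n as u +
     (if score M n as w < score M n as u then T_minimiser M n as w ws
      else T_minimiser M n as u ws) + 1"

fun T_vertices_except :: "nat \<Rightarrow> nat \<Rightarrow> nat" where
  "T_vertices_except s 0 = 1"
| "T_vertices_except s (Suc i) = T_vertices_except s i + 1"

fun T_delete_vertex :: "nat \<Rightarrow> nat list \<Rightarrow> nat" where
  "T_delete_vertex u [] = 1"
| "T_delete_vertex u (w # ws) = (if u = w then 0 else T_delete_vertex u ws) + 1"

fun T_greedy_sets :: "bool list list \<Rightarrow> nat \<Rightarrow> nat \<Rightarrow> nat list \<Rightarrow> nat list \<Rightarrow> nat" where
  "T_greedy_sets M n 0 as ws = 1"
| "T_greedy_sets M n (Suc k) as [] = 1"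
| "T_greedy_sets M n (Suc k) as (w # ws) =
     T_minimiser M n as w ws +
     (let u = minimiser M n as w ws
      in T_delete_vertex u (w # ws) +
         T_greedy_sets M n k (u # as) (delete_vertex u (w # ws))) + 1"

fun T_no_arc_to :: "bool list list \<Rightarrow> nat \<Rightarrow> nat list \<Rightarrow> nat" where
  "T_no_arc_to M v [] = 1"
| "T_no_arc_to M v (a # as) = T_nth M v + T_nth (M ! v) a + T_no_arc_to M v as + 1"

fun T_non_in_neighbours :: "bool list list \<Rightarrow> nat list \<Rightarrow> nat \<Rightarrow> nat" where
  "T_non_in_neighbours M as 0 = 1"
| "T_non_in_neighbours M as (Suc v) = T_no_arc_to M v as + T_non_in_neighbours M as v + 1"

fun T_greedy_algorithm :: "bool list list \<Rightarrow> nat \<Rightarrow> nat \<Rightarrow> nat" where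
  "T_greedy_algorithm M d s =
     T_length M +
     (let n = length M
      in T_vertices_except s n +
         T_greedy_sets M n (n - 1) [s] (vertices_except s n) +
         T_nth (greedy_sets M n (n - 1) [s] (vertices_except s n)) (n div (2 * d) - 1) +
         (let as = greedy_sets M n (n - 1) [s] (vertices_except s n) ! (n div (2 * d) - 1)
          in T_non_in_neighbours M as n))"

end

theory Submission
  imports Defs
begin

text \<open>A \<open>d\<close>-regular digraph has \<open>2 * d^2\<close> paths of length two with an end in a given vertex, and
  in an oriented graph none of them is closed. Averaging the score over the vertices outside
  \<open>S t\<close> therefore gives, by induction on \<open>t\<close>, that at most \<open>d^2 * t * (t - 1) / (n - 1)\<close> paths of
  length two start and end in \<open>S t\<close>. Of the \<open>d * card A\<close> arcs leaving \<open>A\<close>, each one that misses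
  \<open>B\<close> extends to such a path of \<open>A\<close>, so
  \<open>e(A,B) \<ge> d * k - d^2 * k * (k - 1) / (n - 1)\<close> for \<open>k = card A\<close>, and at
  \<open>k = \<lfloor>n / (2 * d)\<rfloor>\<close> this is at least \<open>n / 4\<close>.\<close>

section \<open>Greedy selection of a set of small weight\<close>

text \<open>The bound is the expected weight inside a uniformly random \<open>t\<close>-subset of
  \<open>V\<close>, since the total weight is \<open>c * card V\<close>. A minimising
  \<open>u\<close> has at most the average score outside \<open>S t\<close>, and this keeps the
  weight below that expectation. The factor \<open>real (card V) - 1\<close> replaces a
  division.\<close>

lemma greedy_weight_le:
  fixes w :: "'a \<Rightarrow> 'a \<Rightarrow> real" and S :: "nat \<Rightarrow> 'a set"
  assumes fin: "finite V"
    and loops: "\<And>a. a \<in> V \<Longrightarrow> w a a = 0"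
    and degree: "\<And>a. a \<in> V \<Longrightarrow> (\<Sum>b\<in>V. w a b + w b a) = 2 * c"
    and start: "S 1 = {v}" "v \<in> V"
    and step: "\<And>t. t \<in> {1..<card V} \<Longrightarrow> \<exists>u.
      is_arg_min (\<lambda>u. \<Sum>a\<in>S t. w a u + w u a) (\<lambda>u. u \<in> V - S t) u \<and> S (Suc t) = S t \<union> {u}"
    and t: "1 \<le> t" "t < card V"
  shows "S t \<subseteq> V \<and> card (S t) = t \<and>
    (real (card V) - 1) * (\<Sum>a\<in>S t. \<Sum>b\<in>S t. w a b) \<le> c * real t * (real t - 1)"
  using t
proof (induction t rule: nat_induct_at_least)
  case base
  then show ?case using start loops by simp
next
  case (Suc t)
  let ?n = "real (card V)" and ?f = "\<lambda>u. \<Sum>a\<in>S t. w a u + w u a"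
  define E where "E = (\<Sum>a\<in>S t. \<Sum>b\<in>S t. w a b)"
  have sub: "S t \<subseteq> V" and card: "card (S t) = t"
    and IH: "(?n - 1) * E \<le> c * real t * (real t - 1)"
    using Suc unfolding E_def by auto
  have finS: "finite (S t)" using sub fin finite_subset by blast
  obtain u where min: "is_arg_min ?f (\<lambda>u. u \<in> V - S t) u" and S: "S (Suc t) = S t \<union> {u}"
    using step[of t] Suc by auto
  have le: "?f u \<le> ?f x" if "x \<in> V - S t" for x
    using min that by (auto simp: is_arg_min_linorder)
  have u: "u \<in> V" "u \<notin> S t" using min by (auto simp: is_arg_min_linorder)
  have cardD: "real (card (V - S t)) = ?n - real t"
    using card_Diff_subset[OF finS sub] card Suc by (simp add: of_nat_diff)
  have "(?n - real t) * ?f u \<le> (\<Sum>x\<in>V - S t. ?f x)"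
    using sum_bounded_below[of "V - S t" "?f u" ?f] le cardD by simp
  \<comment> \<open>Counted from inside, each \<open>a\<close> sends its whole degree
    \<open>2 * c\<close> out of \<open>S t\<close> except for what stays in
    \<open>S t\<close>.\<close>
  also have "\<dots> = (\<Sum>a\<in>S t. \<Sum>x\<in>V - S t. w a x + w x a)"
    by (rule sum.swap)
  also have "\<dots> = (\<Sum>a\<in>S t. 2 * c - (\<Sum>b\<in>S t. w a b + w b a))"
  proof (rule sum.cong[OF refl])
    fix a assume "a \<in> S t"
    then show "(\<Sum>x\<in>V - S t. w a x + w x a) = 2 * c - (\<Sum>b\<in>S t. w a b + w b a)"
      using sum_diff[OF fin sub, of "\<lambda>x. w a x + w x a"] degree[of a] sub by auto
  qed
  \<comment> \<open>The double sum over \<open>S t\<close> meets every ordered pair twice, whence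
    \<open>2 * E\<close>.\<close>
  also have "\<dots> = 2 * c * real t - 2 * E"
    using sum.swap[of "\<lambda>a b. w b a" "S t" "S t"]
    by (simp add: sum_subtractf sum.distrib card E_def)
  finally have avg: "(?n - real t) * ?f u \<le> 2 * c * real t - 2 * E" .
  have E': "(\<Sum>a\<in>S (Suc t). \<Sum>b\<in>S (Suc t). w a b) = E + ?f u"
    using u finS loops[of u] by (simp add: S E_def sum.distrib)
  \<comment> \<open>\<open>Suc t < card V\<close> makes the coefficient of \<open>E\<close> below
    nonnegative, so \<open>IH\<close> can be multiplied by it.\<close>
  have nt: "?n - real t - 2 \<ge> 0" using Suc by linarith
  have "(?n - real t) * ((?n - 1) * (E + ?f u)) =
      (?n - 1) * ((?n - real t) * E) + (?n - 1) * ((?n - real t) * ?f u)"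
    by (simp add: algebra_simps)
  also have "\<dots> \<le> (?n - 1) * ((?n - real t) * E) + (?n - 1) * (2 * c * real t - 2 * E)"
    using avg Suc by (intro add_left_mono mult_left_mono) auto
  also have "\<dots> = (?n - real t - 2) * ((?n - 1) * E) + 2 * c * real t * (?n - 1)"
    by (simp add: algebra_simps)
  also have "\<dots> \<le> (?n - real t - 2) * (c * real t * (real t - 1)) + 2 * c * real t * (?n - 1)"
    using mult_left_mono[OF IH nt] by simp
  \<comment> \<open>The bound solves the recursion exactly:
    \<open>(n - t - 2) * (t - 1) + 2 * (n - 1) = (n - t) * (t + 1)\<close>.\<close>
  also have "\<dots> = (?n - real t) * (c * real (Suc t) * (real (Suc t) - 1))"
    by (simp add: algebra_simps)
  finally have "(?n - 1) * (E + ?f u) \<le> c * real (Suc t) * (real (Suc t) - 1)"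
    using nt by (subst (asm) mult_le_cancel_left_pos) auto
  then show ?case using u finS sub card by (simp add: E'[symmetric]) (simp add: S)
qed

text \<open>With \<open>s = d * k\<close> and \<open>n = 2 * s + r\<close>, four times the
  difference of the two sides is \<open>2 * s * (2 * d - 1) - r * (r - 1)\<close>, which is
  nonnegative because \<open>r < 2 * d\<close> and \<open>d \<le> s\<close>.\<close>

lemma greedy_size_bound:
  fixes n d :: nat
  assumes "d \<ge> 1" "n \<ge> 2 * d"
  defines "k \<equiv> real (n div (2 * d))"
  shows "(real n - 1) * (real n / 4) \<le> (real n - 1) * (real d * k) - real d ^ 2 * k * (k - 1)"
proof -
  define s r where "s = d * (n div (2 * d))" and "r = n mod (2 * d)"
  have n: "n = 2 * s + r" unfolding s_def r_def by (simp flip: mult.assoc)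
  have r: "r < 2 * d" using assms by (simp add: r_def)
  have "n div (2 * d) \<ge> 1" using assms by (simp add: div_greater_zero_iff Suc_le_eq)
  then have sd: "s \<ge> d" by (simp add: s_def)
  have k: "real d * k = real s" by (simp add: k_def s_def)
  have "real d ^ 2 * k * (k - 1) = (real d * k) * (real d * k) - real d * (real d * k)"
    by (simp add: algebra_simps power2_eq_square)
  then have eq: "real d ^ 2 * k * (k - 1) = real s * real s - real d * real s" by (simp only: k)
  \<comment> \<open>For \<open>r = 0\<close> the factor \<open>real r - 1\<close> is negative, so
    the products cannot be compared factor by factor.\<close>
  have "real r * (real r - 1) \<le> (2 * real d) * (2 * real d - 1)"
  proof (cases "r = 0")
    case False
    then show ?thesis using r assms by (intro mult_mono) auto
  qed (use assms in auto)
  also have "\<dots> \<le> (2 * real s) * (2 * real d - 1)"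
    using sd assms by (intro mult_right_mono) auto
  finally have "(real n - 1) * real n \<le> 4 * ((real n - 1) * real s - (real s * real s - real d * real s))"
    unfolding n by (simp add: algebra_simps)
  moreover have "x / 4 \<le> y" if "x \<le> 4 * y" for x y :: real using that by simp
  ultimately show ?thesis unfolding eq k times_divide_eq_right by blast
qed

section \<open>Paths of length two in a regular oriented graph\<close>

text \<open>The weight to which \<open>greedy_weight_le\<close> is applied.\<close>

definition paths2 :: "'a pair_pre_digraph \<Rightarrow> 'a \<Rightarrow> 'a \<Rightarrow> nat" where
  "paths2 D x z = card {y. (x, y) \<in> parcs D \<and> (y, z) \<in> parcs D}"

text \<open>The adjacency matrix with numerical entries, so that \<open>paths2\<close> is its square
  and counts become sums whose order can be swapped.\<close>

definition adj :: "'a pair_pre_digraph \<Rightarrow> 'a \<Rightarrow> 'a \<Rightarrow> nat" where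
  "adj D x y = of_bool ((x, y) \<in> parcs D)"

context oriented_graph

\<comment> \<open>Counts of arcs and paths as sums\<close>
begin

lemma paths2_conv_sum: "paths2 D x z = (\<Sum>y\<in>pverts D. adj D x y * adj D y z)"
proof -
  have "{y. (x, y) \<in> parcs D \<and> (y, z) \<in> parcs D} =
      pverts D \<inter> {y. (x, y) \<in> parcs D \<and> (y, z) \<in> parcs D}"
    using wellformed' by auto
  then show ?thesis
    using pair_finite_verts by (simp add: paths2_def adj_def sum_of_bool_eq flip: of_bool_conj)
qed

text \<open>A closed path of length two would be a pair of opposite arcs. This supplies the zero
  diagonal that \<open>greedy_weight_le\<close> asks for.\<close>

lemma paths2_refl: "paths2 D x x = 0"
proof -
  have "{y. (x, y) \<in> parcs D \<and> (y, x) \<in> parcs D} = {}" using no_opposite_arcs by blast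
  then show ?thesis unfolding paths2_def by (simp only: card.empty)
qed

lemma num_arcs_conv_sum:
  assumes "finite A" "finite B"
  shows "num_arcs D A B = (\<Sum>x\<in>A. \<Sum>y\<in>B. adj D x y)"
proof -
  have "{(x, y). (x, y) \<in> parcs D \<and> x \<in> A \<and> y \<in> B} = (A \<times> B) \<inter> {e. e \<in> parcs D}" by auto
  then show ?thesis
    using assms
    unfolding num_arcs_def adj_def sum.cartesian_product case_prod_beta'
    by (subst sum_of_bool_eq) auto
qed

text \<open>Identifies the greedy score with the sum minimised in \<open>greedy_weight_le\<close>,
  by separating the paths that end in \<open>u\<close> from those that start there.\<close>

lemma num_2paths_singleton:
  assumes "finite A" "u \<notin> A"
  shows "num_2paths D A {u} = (\<Sum>a\<in>A. paths2 D a u + paths2 D u a)"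
proof -
  let ?mid = "\<lambda>x z. {y. (x, y) \<in> parcs D \<and> (y, z) \<in> parcs D}"
  let ?to = "(\<lambda>(x, y). (x, y, u)) ` (SIGMA x:A. ?mid x u)"
  let ?from = "(\<lambda>(x, y). (u, y, x)) ` (SIGMA x:A. ?mid u x)"
  have fin: "finite (?mid x z)" for x z
    by (rule finite_subset[OF _ pair_finite_verts]) (use wellformed' in auto)
  have "card ?to = (\<Sum>a\<in>A. paths2 D a u)"
    using assms fin by (subst card_image) (auto simp: inj_on_def paths2_def)
  moreover have "card ?from = (\<Sum>a\<in>A. paths2 D u a)"
    using assms fin by (subst card_image) (auto simp: inj_on_def paths2_def)
  moreover have "num_2paths D A {u} = card (?to \<union> ?from)"
    unfolding num_2paths_def by (intro arg_cong[where f = card]) (auto simp: image_iff)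
  \<comment> \<open>A common triple would both start and end in \<open>u\<close>, which is
    impossible as \<open>u\<close> is not in \<open>A\<close>.\<close>
  moreover have "card (?to \<union> ?from) = card ?to + card ?from"
    using assms fin by (intro card_Un_disjoint finite_imageI finite_SigmaI) auto
  ultimately show ?thesis by (simp add: sum.distrib)
qed

lemma num_arcs_singleton_eq_0_iff:
  "finite A \<Longrightarrow> num_arcs D {w} A = 0 \<longleftrightarrow> (\<forall>a\<in>A. (w, a) \<notin> parcs D)"
  by (auto simp: num_arcs_conv_sum adj_def)

end

section \<open>Double counting with the degrees\<close>

locale regular_oriented_graph = oriented_graph +
  fixes d :: nat
  assumes regular: "regular_digraph d D"
begin

lemma
  assumes "v \<in> pverts D"
  shows sum_adj_out: "(\<Sum>y\<in>pverts D. adj D v y) = d"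
    and sum_adj_in: "(\<Sum>y\<in>pverts D. adj D y v) = d"
proof -
  \<comment> \<open>Degrees count arcs; sending an arc at \<open>v\<close> to its other end turns
    them into row and column sums of \<open>adj\<close>.\<close>
  have "out_arcs (with_proj D) v = Pair v ` (pverts D \<inter> {y. (v, y) \<in> parcs D})"
    using wellformed' by (auto simp: image_iff)
  then have "card (pverts D \<inter> {y. (v, y) \<in> parcs D}) = d"
    using regular assms by (auto simp: regular_digraph_def out_degree_def card_image inj_on_def)
  then show "(\<Sum>y\<in>pverts D. adj D v y) = d"
    using pair_finite_verts by (simp add: adj_def sum_of_bool_eq)
  have "in_arcs (with_proj D) v = (\<lambda>y. (y, v)) ` (pverts D \<inter> {y. (y, v) \<in> parcs D})"
    using wellformed' by (auto simp: image_iff)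
  then have "card (pverts D \<inter> {y. (y, v) \<in> parcs D}) = d"
    using regular assms by (auto simp: regular_digraph_def in_degree_def card_image inj_on_def)
  then show "(\<Sum>y\<in>pverts D. adj D y v) = d"
    using pair_finite_verts by (simp add: adj_def sum_of_bool_eq)
qed

text \<open>The \<open>d\<close> out-neighbours and \<open>d\<close> in-neighbours of
  \<open>v\<close> are disjoint and omit \<open>v\<close>. For \<open>d \<ge> 1\<close> this makes
  the index \<open>n div (2 * d)\<close> at least 1.\<close>

lemma card_verts_ge:
  assumes "v \<in> pverts D"
  shows "2 * d < card (pverts D)"
proof -
  have "2 * d = (\<Sum>y\<in>pverts D. adj D v y + adj D y v)"
    using assms by (simp add: sum.distrib sum_adj_out sum_adj_in)
  also have "\<dots> < (\<Sum>y\<in>pverts D. 1)"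
    using assms pair_finite_verts no_opposite_arcs no_loops'
    by (intro sum_strict_mono_ex1) (auto simp: adj_def)
  finally show ?thesis by simp
qed

text \<open>Choosing the two arcs in turn gives \<open>d * d\<close> paths from \<open>a\<close>,
  and as many to \<open>a\<close>. So \<open>c = d ^ 2\<close> in
  \<open>greedy_weight_le\<close>.\<close>

lemma sum_paths2:
  assumes "a \<in> pverts D"
  shows "(\<Sum>b\<in>pverts D. paths2 D a b + paths2 D b a) = 2 * d ^ 2"
proof -
  have "(\<Sum>b\<in>pverts D. paths2 D a b) = (\<Sum>y\<in>pverts D. adj D a y * (\<Sum>b\<in>pverts D. adj D y b))"
    unfolding paths2_conv_sum by (subst sum.swap) (simp add: sum_distrib_left)
  also have "\<dots> = d ^ 2"
    using assms by (simp add: sum_adj_out power2_eq_square flip: sum_distrib_right)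
  moreover have "(\<Sum>b\<in>pverts D. paths2 D b a) =
      (\<Sum>y\<in>pverts D. (\<Sum>b\<in>pverts D. adj D b y) * adj D y a)"
    unfolding paths2_conv_sum by (subst sum.swap) (simp add: sum_distrib_right)
  moreover have "\<dots> = d ^ 2"
    using assms by (simp add: sum_adj_in power2_eq_square flip: sum_distrib_left)
  ultimately show ?thesis by (simp add: sum.distrib)
qed

text \<open>An arc from \<open>A\<close> to a vertex outside \<open>B\<close> continues along some
  arc back into \<open>A\<close>, and distinct arcs yield distinct paths.\<close>

lemma num_arcs_ge:
  assumes "A \<subseteq> pverts D" and B: "B = {w \<in> pverts D. num_arcs D {w} A = 0}"
  shows "d * card A \<le> num_arcs D A B + (\<Sum>a\<in>A. \<Sum>b\<in>A. paths2 D a b)"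
proof -
  have finA: "finite A" using assms(1) pair_finite_verts by (rule finite_subset)
  have finB: "finite B" using B pair_finite_verts by simp
  let ?out = "\<lambda>y. \<Sum>b\<in>A. adj D y b"
  have "d * card A = (\<Sum>a\<in>A. \<Sum>y\<in>pverts D. adj D a y)"
    using assms(1) sum_adj_out by (simp add: subset_iff)
  \<comment> \<open>Each arc from \<open>a\<close> to \<open>y\<close> is charged to
    \<open>B\<close> or to the paths through \<open>y\<close>; \<open>?out y\<close> counts the ways
    to continue into \<open>A\<close>.\<close>
  also have "\<dots> \<le> (\<Sum>a\<in>A. \<Sum>y\<in>pverts D. adj D a y * of_bool (y \<in> B) + adj D a y * ?out y)"
  proof (intro sum_mono)
    fix a y assume "y \<in> pverts D"
    then have "y \<in> B \<or> ?out y > 0" using finA by (auto simp: B num_arcs_conv_sum simp flip: neq0_conv)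
    then show "adj D a y \<le> adj D a y * of_bool (y \<in> B) + adj D a y * ?out y" by auto
  qed
  also have "\<dots> = (\<Sum>a\<in>A. \<Sum>y\<in>pverts D. adj D a y * of_bool (y \<in> B)) +
      (\<Sum>a\<in>A. \<Sum>b\<in>A. paths2 D a b)"
    unfolding paths2_conv_sum
    by (simp add: sum.distrib sum_distrib_left) (rule sum.cong[OF refl], rule sum.swap)
  also have "(\<Sum>a\<in>A. \<Sum>y\<in>pverts D. adj D a y * of_bool (y \<in> B)) = num_arcs D A B"
  proof -
    have "pverts D \<inter> B = B" using B by auto
    then show ?thesis
      using finA finB pair_finite_verts
      by (simp add: num_arcs_conv_sum of_bool_def if_distrib[of "\<lambda>x. _ * x"] flip: sum.inter_restrict cong: if_cong)
  qed
  finally show ?thesis .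
qed

theorem greedy_output_correct:
  assumes d: "d \<ge> 1" and v: "v \<in> pverts D" and out: "greedy_output D d v A B"
  shows "A \<subseteq> pverts D" "B \<subseteq> pverts D"
    "real (num_arcs D A B) \<ge> real (card (pverts D)) / 4" "num_arcs D B A = 0"
proof -
  define n k where "n = card (pverts D)" and "k = n div (2 * d)"
  obtain S where run: "greedy_run D v S" and A: "A = S k"
    and B: "B = {w \<in> pverts D. num_arcs D {w} A = 0}"
    using out by (auto simp: greedy_output_def n_def k_def)
  have n: "2 * d < n" using card_verts_ge[OF v] by (simp add: n_def)
  have k: "1 \<le> k" "k < n" using n d by (auto simp: k_def div_greater_zero_iff Suc_le_eq)
  \<comment> \<open>Gives finiteness of \<open>S t\<close>, with which the score is rewritten as the
    sum in the \<open>step\<close> premise of \<open>greedy_weight_le\<close>; hence it comes before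
    \<open>main\<close>.\<close>
  have subV: "S t \<subseteq> pverts D" if "1 \<le> t" "t \<le> n" for t
    using that
  proof (induction t rule: nat_induct_at_least)
    case base
    then show ?case using run v by (simp add: greedy_run_def)
  next
    case (Suc t)
    then have "t \<in> {1..<card (pverts D)}" by (simp add: n_def)
    then obtain u where "u \<in> pverts D" "S (Suc t) = S t \<union> {u}"
      using run unfolding greedy_run_def is_arg_min_def by blast
    then show ?case using Suc by simp
  qed
  let ?w = "\<lambda>a b. real (paths2 D a b)"
  have step: "\<exists>u. is_arg_min (\<lambda>u. \<Sum>a\<in>S t. ?w a u + ?w u a) (\<lambda>u. u \<in> pverts D - S t) u \<and>
      S (Suc t) = S t \<union> {u}" if t: "t \<in> {1..<card (pverts D)}" for t
  proof -
    obtain u where u: "is_arg_min (\<lambda>u. num_2paths D (S t) {u}) (\<lambda>u. u \<in> pverts D - S t) u"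
      "S (Suc t) = S t \<union> {u}"
      using run t unfolding greedy_run_def by blast
    have fin: "finite (S t)"
      using subV[of t] t pair_finite_verts by (intro finite_subset[of "S t"]) (auto simp: n_def)
    \<comment> \<open>The two scores agree off \<open>S t\<close>, which suffices because the
      candidates range only there.\<close>
    have "(\<Sum>a\<in>S t. ?w a x + ?w x a) = real (num_2paths D (S t) {x})" if "x \<notin> S t" for x
      using that fin by (simp add: num_2paths_singleton)
    then show ?thesis using u by (intro exI[of _ u]) (auto simp: is_arg_min_linorder)
  qed
  have degree: "(\<Sum>b\<in>pverts D. ?w a b + ?w b a) = 2 * real d ^ 2" if "a \<in> pverts D" for a
    using arg_cong[OF sum_paths2[OF that], of real] by simp
  have main: "S k \<subseteq> pverts D \<and> card (S k) = k \<and>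
    (real (card (pverts D)) - 1) * (\<Sum>a\<in>S k. \<Sum>b\<in>S k. ?w a b) \<le> real d ^ 2 * real k * (real k - 1)"
    using k run v
    by (intro greedy_weight_le[of "pverts D" ?w "real d ^ 2" S v k] pair_finite_verts degree step)
      (auto simp: paths2_refl greedy_run_def n_def)
  then show "A \<subseteq> pverts D" by (simp add: A)
  show "B \<subseteq> pverts D" by (auto simp: B)
  have fin: "finite A" "finite B"
    using \<open>A \<subseteq> pverts D\<close> \<open>B \<subseteq> pverts D\<close> by (simp_all add: finite_subset[OF _ pair_finite_verts])
  then show "num_arcs D B A = 0" by (auto simp: B num_arcs_conv_sum)
  define E where "E = (\<Sum>a\<in>A. \<Sum>b\<in>A. ?w a b)"
  have "real d * real k \<le> real (num_arcs D A B) + E"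
    using num_arcs_ge[OF \<open>A \<subseteq> pverts D\<close> B] main unfolding E_def A
    by (simp flip: of_nat_mult of_nat_add of_nat_sum)
  then have "(real n - 1) * (real d * real k) \<le> (real n - 1) * (real (num_arcs D A B) + E)"
    using n by (intro mult_left_mono) auto
  moreover have "(real n - 1) * E \<le> real d ^ 2 * real k * (real k - 1)"
    using main by (simp add: E_def A n_def)
  moreover have "(real n - 1) * (real n / 4) \<le>
      (real n - 1) * (real d * real k) - real d ^ 2 * real k * (real k - 1)"
    using greedy_size_bound[of d n] d n by (simp add: k_def)
  \<comment> \<open>The common factor \<open>n - 1\<close> is cancelled last; it is positive because
    \<open>2 * d < n\<close>.\<close>
  ultimately have "(real n - 1) * (real n / 4) \<le> (real n - 1) * real (num_arcs D A B)"
    by (simp add: distrib_left)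
  then show "real (num_arcs D A B) \<ge> real (card (pverts D)) / 4"
    using n d by (subst (asm) mult_le_cancel_left_pos) (auto simp: n_def)
qed

end

section \<open>Correctness of the executable version\<close>

text \<open>\<open>w\<close> holds the best candidate so far, so the induction is over arbitrary
  \<open>w\<close>.\<close>

lemma minimiser_is_arg_min:
  "is_arg_min (score M n as) (\<lambda>u. u \<in> set (w # ws)) (minimiser M n as w ws)"
proof (induction ws arbitrary: w)
  case (Cons x ws)
  show ?case
    using Cons[of x] Cons[of w] by (fastforce simp: is_arg_min_linorder)
qed (simp add: is_arg_min_linorder)

lemma delete_vertex_eq_remove1: "delete_vertex u ws = remove1 u ws"
  by (induction ws) auto

lemma set_vertices_except: "set (vertices_except s n) = {..<n} - {s}"
proof -
  have "i \<in> set (vertices_except s n) \<longleftrightarrow> i < n \<and> i \<noteq> s" for i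
    by (induction n) (auto simp: less_Suc_eq)
  then show ?thesis by auto
qed

lemma distinct_vertices_except: "distinct (vertices_except s n)"
  by (induction n) (auto simp: set_vertices_except)

lemma length_vertices_except: "s < n \<Longrightarrow> length (vertices_except s n) = n - 1"
  using distinct_card[OF distinct_vertices_except[of s n]] by (simp add: set_vertices_except)

text \<open>With \<open>length ws = k\<close> the complement runs out exactly when the steps do, so
  the early exit on \<open>[]\<close> never occurs.\<close>

lemma length_greedy_sets: "length ws = k \<Longrightarrow> length (greedy_sets M n k as ws) = Suc k"
proof (induction M n k as ws rule: greedy_sets.induct)
  case (3 M n k as w ws)
  have "minimiser M n as w ws \<in> set (w # ws)"
    using minimiser_is_arg_min[of M n as w ws] by (auto simp: is_arg_min_def)
  then show ?case
    using 3 by (simp add: Let_def delete_vertex_eq_remove1 length_remove1 del: remove1.simps)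
qed auto

lemma greedy_sets_0: "greedy_sets M n k as ws ! 0 = as"
  by (induction M n k as ws rule: greedy_sets.induct) (auto simp: Let_def)

text \<open>Each call moves one vertex from \<open>ws\<close> to \<open>as\<close>, so
  \<open>set as \<union> set ws\<close> never changes. Describing the candidates as a difference
  from this union lets the statement pass unchanged from the recursive call.\<close>

lemma greedy_sets_step:
  assumes "length ws = k" "distinct (as @ ws)" "i < k"
  shows "\<exists>u. is_arg_min (score M n (greedy_sets M n k as ws ! i))
      (\<lambda>u. u \<in> set as \<union> set ws - set (greedy_sets M n k as ws ! i)) u \<and>
    greedy_sets M n k as ws ! Suc i = u # greedy_sets M n k as ws ! i"
  using assms
proof (induction M n k as ws arbitrary: i rule: greedy_sets.induct)
  case (3 M n k as w ws)
  define u W W' where "u = minimiser M n as w ws" and "W = w # ws" and "W' = delete_vertex u W"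
  have u: "is_arg_min (score M n as) (\<lambda>u. u \<in> set W) u"
    unfolding u_def W_def by (rule minimiser_is_arg_min)
  then have mem: "u \<in> set W" by (simp add: is_arg_min_def)
  have W: "length W = Suc k" "distinct W" "distinct as" "set as \<inter> set W = {}"
    using "3.prems" by (auto simp: W_def)
  have len: "length W' = k" and dist: "distinct ((u # as) @ W')"
    and un: "set (u # as) \<union> set W' = set as \<union> set W"
    using mem W by (auto simp: W'_def delete_vertex_eq_remove1 length_remove1)
  have sets: "greedy_sets M n (Suc k) as W = as # greedy_sets M n k (u # as) W'"
    by (simp add: W_def W'_def u_def Let_def)
  have "\<exists>u. is_arg_min (score M n (greedy_sets M n (Suc k) as W ! i))
      (\<lambda>u. u \<in> set as \<union> set W - set (greedy_sets M n (Suc k) as W ! i)) u \<and>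
    greedy_sets M n (Suc k) as W ! Suc i = u # greedy_sets M n (Suc k) as W ! i"
  \<comment> \<open>Index 0 is the choice made now; index \<open>Suc j\<close> is index
    \<open>j\<close> of the recursive call.\<close>
  proof (cases i)
    case 0
    have "set as \<union> set W - set as = set W" using W by auto
    then show ?thesis using u 0 by (auto simp: sets greedy_sets_0)
  next
    case (Suc j)
    then show ?thesis
      using "3.IH"[OF u_def, folded W_def, folded W'_def, OF len dist, of j, unfolded un] "3.prems"(3)
      by (simp add: sets)
  qed
  then show ?case by (simp only: W_def)
qed auto

lemma greedy_sets_nth:
  assumes "length ws = k" "distinct (as @ ws)" "i \<le> k"
  shows "distinct (greedy_sets M n k as ws ! i) \<and>
    set (greedy_sets M n k as ws ! i) \<subseteq> set as \<union> set ws"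
  using assms(3)
proof (induction i)
  case 0
  then show ?case using assms by (auto simp: greedy_sets_0)
next
  case (Suc i)
  then show ?case
    using greedy_sets_step[OF assms(1,2), of i M n] by (auto simp: is_arg_min_def)
qed

lemma no_arc_to_iff: "no_arc_to M v as \<longleftrightarrow> (\<forall>a\<in>set as. \<not> M ! v ! a)"
  by (induction as) auto

lemma set_non_in_neighbours: "set (non_in_neighbours M as n) = {v. v < n \<and> no_arc_to M v as}"
  by (induction n) (auto simp: less_Suc_eq)

lemma count_paths_eq_card: "count_paths M x z n = card {y. y < n \<and> M ! x ! y \<and> M ! y ! z}"
proof (induction n)
  case (Suc n)
  have "{y. y < Suc n \<and> M ! x ! y \<and> M ! y ! z} =
      (if M ! x ! n \<and> M ! n ! z then insert n else id) {y. y < n \<and> M ! x ! y \<and> M ! y ! z}"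
    by (auto simp: less_Suc_eq)
  then show ?case using Suc by simp
qed simp

section \<open>From list indices to vertices\<close>

context oriented_graph
begin

lemma count_paths_eq_paths2:
  assumes "represents vs M D" "x < length vs" "z < length vs"
  shows "count_paths M x z (length vs) = paths2 D (vs ! x) (vs ! z)"
proof -
  let ?Y = "{y. y < length vs \<and> M ! x ! y \<and> M ! y ! z}"
  have entry: "M ! i ! j \<longleftrightarrow> (vs ! i, vs ! j) \<in> parcs D" if "i < length vs" "j < length vs" for i j
    using assms(1) that unfolding represents_def by blast
  have vs: "distinct vs" "set vs = pverts D"
    using assms(1) unfolding represents_def by blast+
  have inj: "inj_on ((!) vs) ?Y"
    by (rule inj_on_nth[OF vs(1)]) simp
  have image: "(!) vs ` ?Y = {y. (vs ! x, y) \<in> parcs D \<and> (y, vs ! z) \<in> parcs D}"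
  proof (intro set_eqI iffI)
    \<comment> \<open>A middle vertex is an endpoint of an arc, so it is a vertex by well-formedness
      and has an index in \<open>vs\<close>.\<close>
    fix y assume y: "y \<in> {y. (vs ! x, y) \<in> parcs D \<and> (y, vs ! z) \<in> parcs D}"
    then have "y \<in> set vs" using wellformed' unfolding vs by blast
    then obtain i where "i < length vs" "y = vs ! i" unfolding in_set_conv_nth by blast
    then show "y \<in> (!) vs ` ?Y" using y entry assms(2,3) by blast
  next
    fix y assume "y \<in> (!) vs ` ?Y"
    then show "y \<in> {y. (vs ! x, y) \<in> parcs D \<and> (y, vs ! z) \<in> parcs D}"
      using entry assms(2,3) by blast
  qed
  show ?thesis
    unfolding count_paths_eq_card paths2_def image[symmetric] by (rule card_image[OF inj, symmetric])
qed

lemma score_eq_num_2paths: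
  assumes "represents vs M D" and as: "distinct as" "set as \<subseteq> {..<length vs}"
    and u: "u < length vs" "u \<notin> set as"
  shows "score M (length vs) as u = num_2paths D ((!) vs ` set as) {vs ! u}"
proof -
  have inj: "inj_on ((!) vs) {..<length vs}"
    using assms(1) by (simp add: represents_def inj_on_nth)
  have "score M (length vs) as u =
      (\<Sum>a\<in>set as. paths2 D (vs ! a) (vs ! u) + paths2 D (vs ! u) (vs ! a))"
    using as u count_paths_eq_paths2[OF assms(1)] by (induction as) auto
  also have "\<dots> = (\<Sum>a\<in>(!) vs ` set as. paths2 D a (vs ! u) + paths2 D (vs ! u) a)"
    using inj as by (subst sum.reindex) (auto intro: inj_on_subset)
  \<comment> \<open>Injectivity of indexing keeps \<open>vs ! u\<close> outside the image, as
    \<open>num_2paths_singleton\<close> requires.\<close>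
  also have "vs ! u \<notin> (!) vs ` set as"
    using inj as u by (auto dest!: inj_onD)
  then have "(\<Sum>a\<in>(!) vs ` set as. paths2 D a (vs ! u) + paths2 D (vs ! u) a) =
      num_2paths D ((!) vs ` set as) {vs ! u}"
    by (simp add: num_2paths_singleton)
  finally show ?thesis .
qed

end

context regular_oriented_graph
begin

lemma greedy_algorithm_correct:
  assumes d: "d \<ge> 1" and rep: "represents vs M D" and s: "s < length vs"
    and alg: "greedy_algorithm M d s = (as, bs)"
  shows "greedy_output D d (vs ! s) ((!) vs ` set as) ((!) vs ` set bs)"
proof -
  define n where "n = length vs"
  define L where "L = greedy_sets M n (n - 1) [s] (vertices_except s n)"
  \<comment> \<open>\<open>L\<close> has the one-element set at index 0, whereas a run numbers it 1;
    \<open>S 0\<close> does not occur in a run.\<close>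
  define S where "S t = (!) vs ` set (L ! (t - 1))" for t
  define k where "k = n div (2 * d)"
  have M: "length M = n" and set_vs: "set vs = pverts D" and dist_vs: "distinct vs"
    using rep by (auto simp: represents_def n_def)
  have n: "card (pverts D) = n"
    using dist_vs by (simp add: distinct_card n_def flip: set_vs)
  have inj: "inj_on ((!) vs) {..<n}"
    using dist_vs by (simp add: n_def inj_on_nth)
  have verts: "(!) vs ` {..<n} = pverts D"
    using nth_image[of n vs] by (simp add: n_def set_vs lessThan_atLeast0)
  have len: "length (vertices_except s n) = n - 1"
    using s by (simp add: n_def length_vertices_except)
  have dist: "distinct ([s] @ vertices_except s n)"
    by (simp add: set_vertices_except distinct_vertices_except)
  have un: "set [s] \<union> set (vertices_except s n) = {..<n}"
    using s by (auto simp: set_vertices_except n_def)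
  have L: "distinct (L ! i)" "set (L ! i) \<subseteq> {..<n}" if "i < n" for i
    using greedy_sets_nth[OF len dist, of i M n] that unfolding un by (auto simp: L_def)
  have k: "1 \<le> k" "k \<le> n"
    using card_verts_ge[of "vs ! s"] d nth_mem[OF s] unfolding set_vs
    by (auto simp: k_def n div_greater_zero_iff Suc_le_eq)
  have as: "as = L ! (k - 1)" and bs: "bs = non_in_neighbours M as n"
    using alg by (auto simp: Let_def M L_def k_def)
  have "greedy_run D (vs ! s) S"
    unfolding greedy_run_def n
  proof (intro conjI ballI)
    show "S 1 = {vs ! s}" by (simp add: S_def L_def greedy_sets_0)
  next
    fix t assume t: "t \<in> {1..<n}"
    define l where "l = L ! (t - 1)"
    have t': "t - 1 < n" "t - 1 < n - 1" "Suc (t - 1) = t" using t by auto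
    from t'(1) have l: "distinct l" "set l \<subseteq> {..<n}" unfolding l_def by (rule L)+
    obtain u where u: "is_arg_min (score M n l) (\<lambda>u. u \<in> {..<n} - set l) u" "L ! t = u # l"
      using greedy_sets_step[OF len dist t'(2), of M] unfolding un t'(3) l_def L_def by blast
    \<comment> \<open>Injectivity carries complements to complements, so minimising over indices is
      minimising over vertices.\<close>
    have image: "pverts D - S t = (!) vs ` ({..<n} - set l)"
      using inj_on_image_set_diff[OF inj, of "{..<n}" "set l"] l
      by (simp add: verts S_def l_def)
    have score: "score M n l x = num_2paths D (S t) {vs ! x}" if "x \<in> {..<n} - set l" for x
      using score_eq_num_2paths[OF rep, of l x] l that by (simp add: n_def S_def l_def)
    have "is_arg_min (\<lambda>u. num_2paths D (S t) {u}) (\<lambda>u. u \<in> pverts D - S t) (vs ! u)"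
      using u(1) score unfolding image by (auto simp: is_arg_min_linorder)
    moreover have "S (Suc t) = S t \<union> {vs ! u}" using u(2) by (simp add: S_def l_def)
    ultimately show "\<exists>u. is_arg_min (\<lambda>u. num_2paths D (S t) {u})
        (\<lambda>u. u \<in> pverts D - S t) u \<and> S (Suc t) = S t \<union> {u}" by blast
  qed
  moreover have "(!) vs ` set as = S k" by (simp add: as S_def)
  moreover have "(!) vs ` set bs = {w \<in> pverts D. num_arcs D {w} ((!) vs ` set as) = 0}"
  proof -
    have "k - 1 < n" using k by linarith
    then have "set as \<subseteq> {..<n}" unfolding as by (rule L)
    then have "M ! v ! a \<longleftrightarrow> (vs ! v, vs ! a) \<in> parcs D" if "v < n" "a \<in> set as" for v a
      using that rep by (auto simp: represents_def n_def)
    then have "num_arcs D {vs ! v} ((!) vs ` set as) = 0 \<longleftrightarrow> no_arc_to M v as" if "v < n" for v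
      using that by (simp add: num_arcs_singleton_eq_0_iff no_arc_to_iff)
    then show ?thesis unfolding bs by (auto simp: set_non_in_neighbours simp flip: verts)
  qed
  ultimately show ?thesis unfolding greedy_output_def n k_def by blast
qed

end

section \<open>Running time\<close>

text \<open>Squareness puts every index below \<open>length M\<close> in range within a row too, so
  each access costs at most \<open>length M\<close>.\<close>

locale square_matrix =
  fixes M :: "bool list list"
  assumes square: "row \<in> set M \<Longrightarrow> length row = length M"
begin

lemma T_nth_row_le: "x < length M \<Longrightarrow> T_nth M x \<le> length M"
  by (simp add: T_nth)

lemma T_nth_entry_le: "x < length M \<Longrightarrow> y < length M \<Longrightarrow> T_nth (M ! x) y \<le> length M"
  by (simp add: T_nth square)

text \<open>Four list accesses per middle vertex, plus one unit for the call.\<close>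

lemma T_count_paths_le:
  assumes "x < length M" "z < length M" "k \<le> length M"
  shows "T_count_paths M x z k \<le> k * (4 * length M + 1) + 1"
  using assms(3)
proof (induction k)
  case (Suc k)
  have "T_nth M x + T_nth (M ! x) k + (T_nth M k + T_nth (M ! k) z) \<le> 4 * length M"
    using T_nth_row_le[of x] T_nth_entry_le[of x k] T_nth_row_le[of k] T_nth_entry_le[of k z] assms Suc
    by linarith
  then show ?case using Suc by simp
qed simp

lemma T_score_le:
  assumes "set as \<subseteq> {..<length M}" "u < length M"
  shows "T_score M (length M) as u \<le>
    length as * (2 * (length M * (4 * length M + 1) + 1) + 1) + 1"
  using assms(1)
proof (induction as)
  case (Cons a as)
  have "T_count_paths M a u (length M) \<le> length M * (4 * length M + 1) + 1"
    "T_count_paths M u a (length M) \<le> length M * (4 * length M + 1) + 1"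
    using Cons assms T_count_paths_le[of a u "length M"] T_count_paths_le[of u a "length M"] by auto
  then show ?case using Cons by simp
qed simp

text \<open>The bound of \<open>T_score_le\<close> at list length \<open>length M\<close>, cubic in
  that length.\<close>

definition score_bound :: nat where
  "score_bound = length M * (2 * (length M * (4 * length M + 1) + 1) + 1) + 1"

lemma T_score_le_bound:
  assumes "set as \<subseteq> {..<length M}" "u < length M" "length as \<le> length M"
  shows "T_score M (length M) as u \<le> score_bound"
proof -
  have "T_score M (length M) as u \<le>
      length as * (2 * (length M * (4 * length M + 1) + 1) + 1) + 1"
    using assms by (intro T_score_le)
  also have "\<dots> \<le> score_bound"
    unfolding score_bound_def using assms by (intro add_right_mono mult_right_mono) auto
  finally show ?thesis .
qed

text \<open>Each candidate costs two scores, since that of the best one so far is computed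
  again.\<close>

lemma T_minimiser_le:
  assumes "set as \<subseteq> {..<length M}" "length as \<le> length M" "set (w # ws) \<subseteq> {..<length M}"
  shows "T_minimiser M (length M) as w ws \<le> length ws * (2 * score_bound + 1) + 1"
  using assms(3)
proof (induction ws arbitrary: w)
  case (Cons x ws)
  have "T_score M (length M) as w \<le> score_bound" "T_score M (length M) as x \<le> score_bound"
    using assms Cons by (auto intro!: T_score_le_bound)
  then show ?case using Cons.IH[of w] Cons.IH[of x] Cons.prems by auto
qed simp

lemma T_delete_vertex_le: "T_delete_vertex u ws \<le> length ws + 1"
  by (induction ws) auto

text \<open>A step costs one minimisation, one deletion and one unit for the call. Moving
  \<open>u\<close> preserves \<open>length as + length ws\<close>.\<close>

lemma T_greedy_sets_le:
  assumes "set as \<subseteq> {..<length M}" "set ws \<subseteq> {..<length M}" "length as + length ws \<le> length M"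
  shows "T_greedy_sets M (length M) k as ws \<le>
    k * (length M * (2 * score_bound + 1) + length M + 3) + 1"
  using assms
proof (induction k arbitrary: as ws)
  case (Suc k)
  show ?case
  proof (cases ws)
    case (Cons w ws')
    define u where "u = minimiser M (length M) as w ws'"
    have u: "u \<in> set ws"
      using minimiser_is_arg_min[of M "length M" as w ws'] by (auto simp: is_arg_min_def u_def Cons)
    have "T_minimiser M (length M) as w ws' \<le> length ws' * (2 * score_bound + 1) + 1"
      using Suc.prems Cons by (intro T_minimiser_le) auto
    also have "\<dots> \<le> length M * (2 * score_bound + 1) + 1"
      using Suc.prems Cons by (intro add_right_mono mult_right_mono) auto
    finally have "T_minimiser M (length M) as w ws' \<le> length M * (2 * score_bound + 1) + 1" .
    moreover have "T_delete_vertex u ws \<le> length M + 1"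
      using T_delete_vertex_le[of u ws] Suc.prems by linarith
    moreover have "T_greedy_sets M (length M) k (u # as) (delete_vertex u ws) \<le>
        k * (length M * (2 * score_bound + 1) + length M + 3) + 1"
      using Suc.prems u length_pos_if_in_set[OF u] set_remove1_subset[of u ws]
      by (intro Suc.IH)
        (auto simp: delete_vertex_eq_remove1 length_remove1 simp del: length_greater_0_conv)
    ultimately show ?thesis by (simp add: Cons u_def[symmetric] Let_def)
  qed simp
qed simp

lemma T_no_arc_to_le:
  assumes "v < length M" "set as \<subseteq> {..<length M}"
  shows "T_no_arc_to M v as \<le> length as * (2 * length M + 1) + 1"
  using assms(2)
proof (induction as)
  case (Cons a as)
  have "T_nth M v + T_nth (M ! v) a \<le> 2 * length M"
    using T_nth_row_le[of v] T_nth_entry_le[of v a] assms Cons by auto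
  then show ?case using Cons by simp
qed simp

lemma T_non_in_neighbours_le:
  assumes "set as \<subseteq> {..<length M}" "length as \<le> length M" "k \<le> length M"
  shows "T_non_in_neighbours M as k \<le> k * (length M * (2 * length M + 1) + 2) + 1"
  using assms(3)
proof (induction k)
  case (Suc k)
  have "T_no_arc_to M k as \<le> length as * (2 * length M + 1) + 1"
    using Suc assms by (intro T_no_arc_to_le) auto
  also have "\<dots> \<le> length M * (2 * length M + 1) + 1"
    using assms by (intro add_right_mono mult_right_mono) auto
  finally show ?case using Suc by simp
qed simp

lemma T_vertices_except: "T_vertices_except s n = n + 1"
  by (induction n) auto

text \<open>The linear tail collects \<open>T_length\<close>, \<open>T_vertices_except\<close>, the
  final list access and the base costs of the two loops.\<close>

lemma T_greedy_algorithm_le: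
  assumes s: "s < length M"
  shows "T_greedy_algorithm M d s \<le>
    length M * (length M * (2 * score_bound + 1) + length M + 3) +
    length M * (length M * (2 * length M + 1) + 2) + 3 * length M + 4"
proof -
  define n where "n = length M"
  define ws where "ws = vertices_except s n"
  define L where "L = greedy_sets M n (n - 1) [s] ws"
  define i where "i = n div (2 * d) - 1"
  have len: "length ws = n - 1" and dist: "distinct ([s] @ ws)"
    and set: "set [s] \<union> set ws = {..<n}"
    using s by (auto simp: ws_def n_def length_vertices_except set_vertices_except
        distinct_vertices_except)
  have lenL: "length L = n" using length_greedy_sets[OF len] s by (simp add: L_def n_def)
  \<comment> \<open>Truncated subtraction and division by zero both give 0, so the index stays in
    range even for \<open>d = 0\<close> or \<open>n < 2 * d\<close>.\<close>
  have "n div (2 * d) \<le> n" by (rule div_le_dividend)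
  moreover have "0 < n" using s by (auto simp: n_def)
  ultimately have i: "i < n" unfolding i_def by linarith
  have Li: "distinct (L ! i)" "set (L ! i) \<subseteq> {..<n}"
    using greedy_sets_nth[OF len dist, of i M n] i unfolding set by (auto simp: L_def)
  then have "length (L ! i) \<le> n"
    using card_mono[of "{..<n}" "set (L ! i)"] by (simp add: distinct_card)
  then have "T_non_in_neighbours M (L ! i) n \<le> n * (n * (2 * n + 1) + 2) + 1"
    using Li T_non_in_neighbours_le[of "L ! i" n] by (simp add: n_def)
  moreover have "T_greedy_sets M n (n - 1) [s] ws \<le>
      n * (n * (2 * score_bound + 1) + n + 3) + 1"
  proof -
    have "T_greedy_sets M n (n - 1) [s] ws \<le>
        (n - 1) * (n * (2 * score_bound + 1) + n + 3) + 1"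
      unfolding n_def by (rule T_greedy_sets_le) (use len set s in \<open>auto simp: n_def\<close>)
    also have "\<dots> \<le> n * (n * (2 * score_bound + 1) + n + 3) + 1"
      by (intro add_right_mono mult_right_mono) auto
    finally show ?thesis .
  qed
  moreover have "T_nth L i \<le> n" using i by (simp add: T_nth lenL)
  ultimately show ?thesis
    unfolding T_greedy_algorithm.simps Let_def n_def[symmetric] ws_def[symmetric]
      L_def[symmetric] i_def[symmetric]
    by (simp add: T_length T_vertices_except n_def)
qed

end

text \<open>The second conjunct makes the executable version an instance of the relational one, so
  the guarantee in the first applies to its output. In the third, \<open>p\<close> is chosen before
  \<open>M\<close>, \<open>d\<close> and \<open>s\<close>.\<close>

theorem proposition6p15:
  shows
    "(\<forall>(D :: 'a pair_pre_digraph) d v A B.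
        d \<ge> 1 \<longrightarrow> oriented_graph D \<longrightarrow> regular_digraph d D \<longrightarrow> v \<in> pverts D \<longrightarrow>
        greedy_output D d v A B \<longrightarrow>
        A \<subseteq> pverts D \<and> B \<subseteq> pverts D \<and>
        real (num_arcs D A B) \<ge> real (card (pverts D)) / 4 \<and> num_arcs D B A = 0) \<and>
     (\<forall>(D :: 'a pair_pre_digraph) d vs M s as bs.
        d \<ge> 1 \<longrightarrow> oriented_graph D \<longrightarrow> regular_digraph d D \<longrightarrow>
        represents vs M D \<longrightarrow> s < length vs \<longrightarrow> greedy_algorithm M d s = (as, bs) \<longrightarrow>
        greedy_output D d (vs ! s) ((!) vs ` set as) ((!) vs ` set bs)) \<and>
     (\<exists>p :: nat poly. \<forall>M d s.
        (\<forall>row\<in>set M. length row = length M) \<longrightarrow> s < length M \<longrightarrow>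
        T_greedy_algorithm M d s \<le> poly p (length M))"
proof (intro conjI)
  have reg: "regular_oriented_graph D d"
    if "oriented_graph D" "regular_digraph d D" for D :: "'a pair_pre_digraph" and d
    using that by (simp add: regular_oriented_graph_def regular_oriented_graph_axioms_def)
  show "\<forall>(D :: 'a pair_pre_digraph) d v A B.
        d \<ge> 1 \<longrightarrow> oriented_graph D \<longrightarrow> regular_digraph d D \<longrightarrow> v \<in> pverts D \<longrightarrow>
        greedy_output D d v A B \<longrightarrow>
        A \<subseteq> pverts D \<and> B \<subseteq> pverts D \<and>
        real (num_arcs D A B) \<ge> real (card (pverts D)) / 4 \<and> num_arcs D B A = 0"
    by (intro allI impI conjI; rule regular_oriented_graph.greedy_output_correct[OF reg])
  show "\<forall>(D :: 'a pair_pre_digraph) d vs M s as bs.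
        d \<ge> 1 \<longrightarrow> oriented_graph D \<longrightarrow> regular_digraph d D \<longrightarrow>
        represents vs M D \<longrightarrow> s < length vs \<longrightarrow> greedy_algorithm M d s = (as, bs) \<longrightarrow>
        greedy_output D d (vs ! s) ((!) vs ` set as) ((!) vs ` set bs)"
    by (intro allI impI; rule regular_oriented_graph.greedy_algorithm_correct[OF reg])
  \<comment> \<open>\<open>q\<close> and \<open>p\<close> copy \<open>score_bound\<close> and the
    bound of \<open>T_greedy_algorithm_le\<close> with the indeterminate \<open>x\<close> for
    \<open>length M\<close>, so evaluation returns that bound.\<close>
  define x :: "nat poly" where "x = [:0, 1:]"
  define q where "q = x * (2 * (x * (4 * x + 1) + 1) + 1) + 1"
  define p where "p = x * (x * (2 * q + 1) + x + 3) + x * (x * (2 * x + 1) + 2) + 3 * x + 4"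
  have "T_greedy_algorithm M d s \<le> poly p (length M)"
    if "\<forall>row\<in>set M. length row = length M" "s < length M" for M d s
  proof -
    interpret square_matrix M using that(1) by unfold_locales simp
    have "poly x (length M) = length M" by (simp add: x_def)
    then show ?thesis
      using T_greedy_algorithm_le[OF that(2), of d] by (simp add: p_def q_def score_bound_def)
  qed
  then show "\<exists>p :: nat poly. \<forall>M d s.
        (\<forall>row\<in>set M. length row = length M) \<longrightarrow> s < length M \<longrightarrow>
        T_greedy_algorithm M d s \<le> poly p (length M)"
    by blast
qed

end
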